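(* The following hold. (i) Let $v,k$ be positive integers and let $(a,b,c)$ be a Pythagorean triple given, up to interchanging $a$ and $b$, by $a=d(m^2-n^2)$, $b=d(2mn)$, $c=d(m^2+n^2)$, where $m,n,d$ are positive integers with $m>n$, $\gcd(m,n)=1$ and $m+n\equiv 1 \pmod 2$. If $(a,b,c)$ has the reciprocal property $R(v,k,1)$, then $m$ divides $v-1$ and $n$ divides $v+1$. (ii) For every positive integer $k$, there exists no Pythagorean triple that has the reciprocal property $R(2,k,1)$. (iii) The only Pythagorean triple (up to interchanging the two legs $a$ and $b$) which has the reciprocal property $R(1,1,1)$ is $(3,4,5)$. (iv) If $k\geq 2$ and $l\ge 1$ are integers with $\gcd(k,l)=1$, then there exists no Pythagorean triple which has the reciprocal property $R(1,k,l)$. (v) Let $v,k,l$ be positive integers with $\gcd(k,l)=1$, $l$ odd and $v$ even. Then there exists no Pythagorean triple which has the reciprocal property $R(v,k,l)$.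
   Context: A Pythagorean triple is a triple $(a,b,c)$ of positive integers with $a^2+b^2=c^2$ ($a,b$ are the leg lengths and $c$ the hypotenuse length of a right triangle). Let $h=ab/c$ be the altitude to the hypotenuse of this triangle. For positive integers $v,k,l$ with $\gcd(k,l)=1$, the triple $(a,b,c)$ is said to have the reciprocal property $R(v,k,l)$ if $$\frac1a+\frac1b+\frac{v}{h}=\frac{k}{l}.$$ *)

theory Defs
  imports Complex_Main "HOL-Number_Theory.Cong"
begin

definition pythagorean_triple :: "int \<Rightarrow> int \<Rightarrow> int \<Rightarrow> bool" where
  "pythagorean_triple a b c \<longleftrightarrow> 0 < a \<and> 0 < b \<and> 0 < c \<and> a\<^sup>2 + b\<^sup>2 = c\<^sup>2"

text \<open>Altitude to the hypotenuse \<open>c\<close> of the right triangle with legs \<open>a\<close>, \<open>b\<close>.\<close>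

definition altitude :: "int \<Rightarrow> int \<Rightarrow> int \<Rightarrow> real" where
  "altitude a b c = real_of_int a * real_of_int b / real_of_int c"

text \<open>The property $R(v,k,l)$ of \<open>(a, b, c)\<close>. It is only meant for positive \<open>v\<close>, \<open>k\<close>, \<open>l\<close> with
  \<open>k\<close>, \<open>l\<close> coprime; these conditions are imposed where the property is used.\<close>

definition reciprocal_property ::
    "int \<Rightarrow> int \<Rightarrow> int \<Rightarrow> int \<Rightarrow> int \<Rightarrow> int \<Rightarrow> bool" where
  "reciprocal_property v k l a b c \<longleftrightarrow>
     1 / real_of_int a + 1 / real_of_int b + real_of_int v / altitude a b c
       = real_of_int k / real_of_int l"

end

theory Submission
  imports Defs
begin

text \<open>
  Clearing denominators turns \<open>R(v,k,l)\<close> into \<open>l (a + b + v c) = k a b\<close>.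
  Part (i) is this equation read modulo \<open>m\<close> and modulo \<open>n\<close>.
  For \<open>v = 1\<close>, the identity \<open>(a + b - c) (a + b + c) = 2 a b\<close> reduces it to \<open>l = k r\<close>, where
  \<open>r = (a + b - c) / 2\<close> is the inradius, an integer; so coprimality forces \<open>k = 1\<close>, and \<open>l = 1\<close> leads to
  \<open>(a - 2) (b - 2) = 2\<close>.
  For \<open>v\<close> even and \<open>l\<close> odd, halving \<open>a\<close>, \<open>b\<close>, \<open>c\<close> doubles \<open>k\<close>; after finitely many halvings exactly
  one leg is odd, and then the left-hand side is odd while the right-hand side is even.
\<close>

text \<open>Since \<open>1 / altitude a b c\<close> is \<open>c / (a * b)\<close>, the three
  summands share the denominator \<open>a * b\<close>. Positivity of \<open>a\<close>,
  \<open>b\<close>, \<open>c\<close> and \<open>l\<close> makes the cross-multiplication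
  reversible.\<close>

lemma reciprocal_property_iff:
  assumes "pythagorean_triple a b c" "0 < l"
  shows "reciprocal_property v k l a b c \<longleftrightarrow> l * (a + b + v * c) = k * a * b"
proof -
  from assms have pos: "real_of_int a > 0" "real_of_int b > 0" "real_of_int c > 0" "real_of_int l > 0"
    by (auto simp: pythagorean_triple_def)
  have "1 / real_of_int a + 1 / real_of_int b + real_of_int v / altitude a b c
      = (real_of_int a + real_of_int b + real_of_int v * real_of_int c) / (real_of_int a * real_of_int b)"
    unfolding altitude_def using pos by (simp add: add_divide_distrib)
  then have "reciprocal_property v k l a b c \<longleftrightarrow>
      (real_of_int a + real_of_int b + real_of_int v * real_of_int c) * real_of_int l
        = real_of_int k * (real_of_int a * real_of_int b)"
    unfolding reciprocal_property_def using pos by (simp add: frac_eq_eq)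
  also have "\<dots> \<longleftrightarrow> real_of_int (l * (a + b + v * c)) = real_of_int (k * a * b)"
    by (simp add: ac_simps)
  finally show ?thesis
    by (simp only: of_int_eq_iff)
qed

text \<open>After one factor \<open>d\<close> is cancelled, the right-hand side vanishes modulo
  \<open>m\<close> and modulo \<open>n\<close>, while the left-hand side becomes
  \<open>(v - 1) * n\<^sup>2\<close> and \<open>(v + 1) * m\<^sup>2\<close> respectively.
  Coprimality then strips off the square.\<close>

lemma dvd_of_parametrized_equation:
  fixes m n d v k :: int
  assumes "d \<noteq> 0" "coprime m n"
    and eq: "d * (m\<^sup>2 - n\<^sup>2) + d * (2 * m * n) + v * (d * (m\<^sup>2 + n\<^sup>2))
           = k * (d * (m\<^sup>2 - n\<^sup>2)) * (d * (2 * m * n))"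
  shows "m dvd v - 1" "n dvd v + 1"
proof -
  have "d * ((m\<^sup>2 - n\<^sup>2) + 2 * m * n + v * (m\<^sup>2 + n\<^sup>2)) = d * (k * d * (m\<^sup>2 - n\<^sup>2) * (2 * m * n))"
    using eq by (simp add: algebra_simps)
  then have eq': "(m\<^sup>2 - n\<^sup>2) + 2 * m * n + v * (m\<^sup>2 + n\<^sup>2) = k * d * (m\<^sup>2 - n\<^sup>2) * (2 * m * n)"
    using \<open>d \<noteq> 0\<close> by (metis mult_cancel_left)
  have "(v - 1) * n\<^sup>2 = m * (k * d * (m\<^sup>2 - n\<^sup>2) * (2 * n) - m - 2 * n - v * m)"
    using eq' by (simp add: algebra_simps power2_eq_square)
  then have "m dvd (v - 1) * n\<^sup>2" by simp
  then show "m dvd v - 1"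
    using \<open>coprime m n\<close> by (simp add: coprime_dvd_mult_left_iff)
  have "(v + 1) * m\<^sup>2 = n * (k * d * (m\<^sup>2 - n\<^sup>2) * (2 * m) + n - 2 * m - v * n)"
    using eq' by (simp add: algebra_simps power2_eq_square)
  then have "n dvd (v + 1) * m\<^sup>2" by simp
  then show "n dvd v + 1"
    using \<open>coprime m n\<close> by (simp add: coprime_dvd_mult_left_iff coprime_commute)
qed

lemma pythagorean_triple_inradius:
  assumes "pythagorean_triple a b c"
  obtains r where "a + b - c = 2 * r" "r * (a + b + c) = a * b"
proof -
  have sq: "a\<^sup>2 + b\<^sup>2 = c\<^sup>2"
    using assms by (simp add: pythagorean_triple_def)
  then have "even (a\<^sup>2 + b\<^sup>2) \<longleftrightarrow> even (c\<^sup>2)" by simp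
  \<comment> \<open>Squaring preserves parity, so \<open>a + b\<close> and \<open>c\<close> agree
    modulo 2.\<close>
  then have "even (a + b - c)" by simp
  then obtain r where r: "a + b - c = 2 * r" by blast
  have "(a + b - c) * (a + b + c) = 2 * (a * b)"
    using sq by (simp add: algebra_simps power2_eq_square)
  then have "r * (a + b + c) = a * b"
    by (simp add: r)
  with r show thesis by (rule that)
qed

lemma reciprocal_one_inradius:
  assumes "pythagorean_triple a b c" "0 < l" "reciprocal_property 1 k l a b c"
  obtains r where "a + b - c = 2 * r" "l = k * r"
proof -
  obtain r where r: "a + b - c = 2 * r" "r * (a + b + c) = a * b"
    using pythagorean_triple_inradius assms(1) by blast
  have "l * (a + b + c) = k * a * b"
    using reciprocal_property_iff[OF assms(1,2), of 1 k] assms(3) by simp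
  \<comment> \<open>Writing \<open>a * b\<close> as \<open>r\<close> times the perimeter puts the
    perimeter on both sides; being positive, it cancels.\<close>
  also have "\<dots> = (k * r) * (a + b + c)"
    by (simp add: r(2) mult.assoc)
  finally have "l = k * r"
    using assms(1) by (simp add: pythagorean_triple_def)
  with r(1) show thesis by (rule that)
qed

lemma reciprocal_one_imp_eq_1:
  assumes "pythagorean_triple a b c" "0 < k" "0 < l" "coprime k l" "reciprocal_property 1 k l a b c"
  shows "k = 1"
proof -
  obtain r where "l = k * r"
    using reciprocal_one_inradius assms by blast
  then have "k dvd l" by simp
  with \<open>coprime k l\<close> have "is_unit k"
    using coprime_common_divisor[of k l k] by simp
  with \<open>0 < k\<close> show ?thesis by simp
qed

lemma reciprocal_one_one_one_iff:
  "pythagorean_triple a b c \<and> reciprocal_property 1 1 1 a b c \<longleftrightarrow>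
     (a, b, c) = (3, 4, 5) \<or> (a, b, c) = (4, 3, 5)"
proof
  assume A: "pythagorean_triple a b c \<and> reciprocal_property 1 1 1 a b c"
  then obtain r where "a + b - c = 2 * r" "1 = 1 * r"
    using reciprocal_one_inradius[of a b c 1 1] by auto
  then have c: "c = a + b - 2" by simp
  have pos: "0 < a" "0 < b" "0 < c" and "a\<^sup>2 + b\<^sup>2 = c\<^sup>2"
    using A by (auto simp: pythagorean_triple_def)
  \<comment> \<open>Inserting \<open>c = a + b - 2\<close> into the Pythagorean equation cancels the
    squares and leaves \<open>a * b - 2 * a - 2 * b + 2 = 0\<close>.\<close>
  then have prod: "(a - 2) * (b - 2) = 2"
    by (simp add: c algebra_simps power2_eq_square)
  then have "a - 2 dvd 2" by (metis dvd_triv_left)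
  then have "\<bar>a - 2\<bar> \<le> 2" using dvd_imp_le_int[of 2 "a - 2"] by simp
  then have "a \<in> {1, 2, 3, 4}" using \<open>0 < a\<close> by auto
  \<comment> \<open>Here \<open>a = 1\<close> would force \<open>b = 0\<close>, and
    \<open>a = 2\<close> would make the product 0.\<close>
  then show "(a, b, c) = (3, 4, 5) \<or> (a, b, c) = (4, 3, 5)"
    using prod pos c by auto
next
  assume "(a, b, c) = (3, 4, 5) \<or> (a, b, c) = (4, 3, 5)"
  then show "pythagorean_triple a b c \<and> reciprocal_property 1 1 1 a b c"
    by (auto simp: pythagorean_triple_def reciprocal_property_def altitude_def)
qed

text \<open>Two odd squares add up to 2 modulo 4, but an even square is 0 modulo 4.\<close>

lemma not_both_odd_if_sum_squares_square:
  fixes a b c :: int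
  assumes "a\<^sup>2 + b\<^sup>2 = c\<^sup>2"
  shows "even a \<or> even b"
proof (rule ccontr)
  assume "\<not> (even a \<or> even b)"
  then obtain x y where x: "a = 2 * x + 1" and y: "b = 2 * y + 1"
    by (auto elim!: oddE)
  have "even (c\<^sup>2)" unfolding assms[symmetric] x y by simp
  then obtain z where z: "c = 2 * z" by auto
  have "4 * (x\<^sup>2 + x + y\<^sup>2 + y) + 2 = 4 * z\<^sup>2"
    using assms unfolding x y z by (simp add: algebra_simps power2_eq_square)
  then show False by presburger
qed

lemma no_solution_even_odd:
  fixes a b c v k l :: int
  assumes "pythagorean_triple a b c" "odd l" "even v"
  shows "l * (a + b + v * c) \<noteq> k * a * b"
  using assms(1)
\<comment> \<open>Descent on the leg \<open>a\<close>. The coefficient \<open>k\<close> must vary as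
  well: the left-hand side is linear in the sides and the right-hand side quadratic, so halving the
  sides replaces \<open>k\<close> by \<open>2 * k\<close>.\<close>
proof (induction "nat a" arbitrary: a b c k rule: less_induct)
  case less
  have pos: "0 < a" "0 < b" "0 < c" and sq: "a\<^sup>2 + b\<^sup>2 = c\<^sup>2"
    using less.prems by (auto simp: pythagorean_triple_def)
  show ?case
  proof (cases "even a \<and> even b")
    case True
    then have "even (c\<^sup>2)" unfolding sq[symmetric] by simp
    then have "even c" by simp
    with True obtain x y z where xyz: "a = 2 * x" "b = 2 * y" "c = 2 * z"
      by (elim conjE evenE)
    have "pythagorean_triple x y z"
      using pos sq by (simp add: pythagorean_triple_def xyz power2_eq_square)
    moreover have "nat x < nat a"
      using pos by (simp add: xyz)
    ultimately have "l * (x + y + v * z) \<noteq> 2 * k * x * y"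
      using less.hyps by blast
    then show ?thesis
      by (simp add: xyz algebra_simps)
  next
    case False
    \<comment> \<open>Now exactly one leg is odd, so \<open>a + b\<close> is odd,
      \<open>v * c\<close> is even and \<open>a * b\<close> is even.\<close>
    with not_both_odd_if_sum_squares_square[OF sq]
    have "odd (l * (a + b + v * c))" "even (k * a * b)"
      using assms(2,3) by auto
    then show ?thesis by metis
  qed
qed

lemma no_reciprocal_even_odd:
  assumes "pythagorean_triple a b c" "0 < l" "odd l" "even v"
  shows "\<not> reciprocal_property v k l a b c"
  using reciprocal_property_iff no_solution_even_odd assms by blast

theorem theorem2:
  shows
    "(\<forall>v k a b c m n d :: int.
        0 < v \<longrightarrow> 0 < k \<longrightarrow> pythagorean_triple a b c \<longrightarrow>
        0 < m \<longrightarrow> 0 < n \<longrightarrow> 0 < d \<longrightarrow> n < m \<longrightarrow> gcd m n = 1 \<longrightarrow> [m + n = 1] (mod 2) \<longrightarrow>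
        (a = d * (m\<^sup>2 - n\<^sup>2) \<and> b = d * (2 * m * n) \<or>
         b = d * (m\<^sup>2 - n\<^sup>2) \<and> a = d * (2 * m * n)) \<longrightarrow>
        c = d * (m\<^sup>2 + n\<^sup>2) \<longrightarrow>
        reciprocal_property v k 1 a b c \<longrightarrow>
        m dvd v - 1 \<and> n dvd v + 1)
     \<and> (\<forall>k :: int. 0 < k \<longrightarrow>
        \<not> (\<exists>a b c. pythagorean_triple a b c \<and> reciprocal_property 2 k 1 a b c))
     \<and> (\<forall>a b c. pythagorean_triple a b c \<and> reciprocal_property 1 1 1 a b c \<longleftrightarrow>
        (a, b, c) = (3, 4, 5) \<or> (a, b, c) = (4, 3, 5))
     \<and> (\<forall>k l :: int. 2 \<le> k \<longrightarrow> 1 \<le> l \<longrightarrow> gcd k l = 1 \<longrightarrow>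
        \<not> (\<exists>a b c. pythagorean_triple a b c \<and> reciprocal_property 1 k l a b c))
     \<and> (\<forall>v k l :: int. 0 < v \<longrightarrow> 0 < k \<longrightarrow> 0 < l \<longrightarrow> gcd k l = 1 \<longrightarrow> odd l \<longrightarrow> even v \<longrightarrow>
        \<not> (\<exists>a b c. pythagorean_triple a b c \<and> reciprocal_property v k l a b c))"
proof (intro conjI)
  show "\<forall>v k a b c m n d :: int.
        0 < v \<longrightarrow> 0 < k \<longrightarrow> pythagorean_triple a b c \<longrightarrow>
        0 < m \<longrightarrow> 0 < n \<longrightarrow> 0 < d \<longrightarrow> n < m \<longrightarrow> gcd m n = 1 \<longrightarrow> [m + n = 1] (mod 2) \<longrightarrow>
        (a = d * (m\<^sup>2 - n\<^sup>2) \<and> b = d * (2 * m * n) \<or>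
         b = d * (m\<^sup>2 - n\<^sup>2) \<and> a = d * (2 * m * n)) \<longrightarrow>
        c = d * (m\<^sup>2 + n\<^sup>2) \<longrightarrow>
        reciprocal_property v k 1 a b c \<longrightarrow>
        m dvd v - 1 \<and> n dvd v + 1"
  proof (intro allI impI)
    fix v k a b c m n d :: int
    assume pt: "pythagorean_triple a b c" and "0 < d" and "gcd m n = 1"
      and ab: "a = d * (m\<^sup>2 - n\<^sup>2) \<and> b = d * (2 * m * n) \<or>
         b = d * (m\<^sup>2 - n\<^sup>2) \<and> a = d * (2 * m * n)"
      and c: "c = d * (m\<^sup>2 + n\<^sup>2)" and R: "reciprocal_property v k 1 a b c"
    have "a + b + v * c = k * a * b"
      using reciprocal_property_iff[OF pt, of 1 v k] R by simp
    \<comment> \<open>The cleared equation is symmetric in \<open>a\<close> and \<open>b\<close>, so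
      both assignments of the legs give the same identity.\<close>
    then have "d * (m\<^sup>2 - n\<^sup>2) + d * (2 * m * n) + v * (d * (m\<^sup>2 + n\<^sup>2))
           = k * (d * (m\<^sup>2 - n\<^sup>2)) * (d * (2 * m * n))"
      using ab unfolding c by (elim disjE conjE) (simp_all only: ac_simps)
    moreover have "d \<noteq> 0" "coprime m n"
      using \<open>0 < d\<close> \<open>gcd m n = 1\<close> by (simp_all add: coprime_iff_gcd_eq_1)
    ultimately show "m dvd v - 1 \<and> n dvd v + 1"
      using dvd_of_parametrized_equation by blast
  qed
next
  show "\<forall>k :: int. 0 < k \<longrightarrow>
        \<not> (\<exists>a b c. pythagorean_triple a b c \<and> reciprocal_property 2 k 1 a b c)"
    \<comment> \<open>This is the parity descent with \<open>l = 1\<close> and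
      \<open>v = 2\<close>.\<close>
    using no_reciprocal_even_odd[of _ _ _ 1 2] by auto
next
  show "\<forall>a b c. pythagorean_triple a b c \<and> reciprocal_property 1 1 1 a b c \<longleftrightarrow>
        (a, b, c) = (3, 4, 5) \<or> (a, b, c) = (4, 3, 5)"
    using reciprocal_one_one_one_iff by blast
next
  show "\<forall>k l :: int. 2 \<le> k \<longrightarrow> 1 \<le> l \<longrightarrow> gcd k l = 1 \<longrightarrow>
        \<not> (\<exists>a b c. pythagorean_triple a b c \<and> reciprocal_property 1 k l a b c)"
  proof (intro allI impI notI)
    fix k l :: int
    assume "2 \<le> k" "1 \<le> l" "gcd k l = 1"
      and "\<exists>a b c. pythagorean_triple a b c \<and> reciprocal_property 1 k l a b c"
    then have "k = 1"
      using reciprocal_one_imp_eq_1[of _ _ _ k l] by (auto simp: coprime_iff_gcd_eq_1)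
    with \<open>2 \<le> k\<close> show False by simp
  qed
next
  show "\<forall>v k l :: int. 0 < v \<longrightarrow> 0 < k \<longrightarrow> 0 < l \<longrightarrow> gcd k l = 1 \<longrightarrow> odd l \<longrightarrow> even v \<longrightarrow>
        \<not> (\<exists>a b c. pythagorean_triple a b c \<and> reciprocal_property v k l a b c)"
    using no_reciprocal_even_odd by blast
qed

end
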